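(* Let $k$ be an even positive integer with $k \geq 6$. Write $k=10t+s$ with $t\ge 0$ an integer and $s\in\{0,2,4,6,8\}$, and put $$u=\begin{cases} t & \text{if } s \in \{6,8\}, \\ t-1 & \text{if } s \in \{0,2,4\}.\end{cases}$$ Then $$S_{\mathfrak{z},2}^{(1,1)}(k;2;1) = \frac{k}{2} -u-2,$$ where $S_{\mathfrak{z},2}^{(1,1)}(k;2;1)$ is the least positive integer $n$ such that for every coloring $\chi:[1,n]\to\{0,1\}$ there exist $x_1,\ldots,x_k\in[1,n]$ (not necessarily distinct) with $x_1+\cdots+x_{k-3}=x_{k-2}+x_{k-1}+x_k$ and $\sum_{i=1}^k\chi(x_i)\equiv 0 \pmod 2$.
   Context: $[a,b]$ denotes the set of integers $j$ with $a\le j\le b$. A 2-coloring of $[1,n]$ is an arbitrary function $\chi:[1,n]\to\{0,1\}$, and colors are added as integers. The quantity is the special case $\ell=1$, $\epsilon=1$, $v=1$, $m=r=2$ of the zero-sum $\ell$-generalized Schur number $S_{\mathfrak{z},m}^{(\ell,\epsilon)}(k;r;v)$, which is the least positive integer $n$ such that every coloring $\chi:[1,n]\to\{0,\ldots,m-1\}$ admits a solution in $[1,n]$ of $x_1+\cdots+x_{k-(rv+\epsilon)} = x_{k-(rv+\epsilon-1)}+\cdots+x_{k-1}+\ell x_k$ with $\sum_{i=1}^k\chi(x_i)\equiv 0\pmod r$. *)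

theory Defs
  imports Main "HOL-Number_Theory.Cong"
begin

text \<open>A tuple \<open>(x\<^sub>1, \<dots>, x\<^sub>k)\<close> is represented by a function on \<open>nat\<close> of which only the values at
  \<open>1, \<dots>, k\<close> matter. The indices below use truncated subtraction, so the equation is the intended
  one for \<open>1 \<le> r * v + \<epsilon> \<le> k\<close>.\<close>

definition schur_solution ::
  "nat \<Rightarrow> nat \<Rightarrow> nat \<Rightarrow> nat \<Rightarrow> nat \<Rightarrow> (nat \<Rightarrow> nat) \<Rightarrow> bool" where
  "schur_solution l \<epsilon> k r v x \<longleftrightarrow>
     (\<Sum>i = 1..k - (r * v + \<epsilon>). x i) =
     (\<Sum>i = k - (r * v + \<epsilon> - 1)..k - 1. x i) + l * x k"

definition zero_sum_solvable ::
  "nat \<Rightarrow> nat \<Rightarrow> nat \<Rightarrow> nat \<Rightarrow> nat \<Rightarrow> nat \<Rightarrow> nat \<Rightarrow> bool" where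
  "zero_sum_solvable m l \<epsilon> k r v n \<longleftrightarrow>
     (\<forall>\<chi> :: nat \<Rightarrow> nat. \<chi> ` {1..n} \<subseteq> {0..<m} \<longrightarrow>
        (\<exists>x. x ` {1..k} \<subseteq> {1..n} \<and> schur_solution l \<epsilon> k r v x \<and>
             [(\<Sum>i = 1..k. \<chi> (x i)) = 0] (mod r)))"

text \<open>The least positive \<open>n\<close> as below is unspecified if there is none; statements about it should
  also assert existence.\<close>

definition zero_sum_schur_number ::
  "nat \<Rightarrow> nat \<Rightarrow> nat \<Rightarrow> nat \<Rightarrow> nat \<Rightarrow> nat \<Rightarrow> nat" where
  "zero_sum_schur_number m l \<epsilon> k r v =
     (LEAST n. 0 < n \<and> zero_sum_solvable m l \<epsilon> k r v n)"

lemma schur_solution_1_1_2_1: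
  assumes "k \<ge> 3"
  shows "schur_solution 1 1 k 2 1 x \<longleftrightarrow>
    (\<Sum>i = 1..k - 3. x i) = x (k - 2) + x (k - 1) + x k"
proof -
  obtain j where k: "k = j + 3"
    using assms by (metis add.commute le_Suc_ex)
  have "{k - 2..k - 1} = {k - 2, k - 1}"
    using k by auto
  then have "(\<Sum>i = k - 2..k - 1. x i) = x (k - 2) + x (k - 1)"
    using k by simp
  then show ?thesis
    by (simp add: schur_solution_def)
qed

end

theory Submission imports Defs begin

text \<open>
  The number is the least \<open>n\<close> with \<open>2k - 7 \<le> 5n\<close>. If \<open>5n < 2k - 7\<close>, give \<open>y\<close> the color \<open>1\<close> iff
  \<open>y > 3n + 4 - k\<close>: since the left side of the equation is at most \<open>3n\<close>, all its terms have color
  \<open>0\<close>, and since it is at least \<open>k - 3\<close>, the three terms on the right all have color \<open>1\<close>.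
  For the value itself put \<open>A = k - 3 - 2n\<close>, which is odd, \<open>B = (A + 1) / 2\<close> and
  \<open>R = 2k - 7 - 4n\<close>. The three solutions
  \<open>1 + \<dots> + 1 = n + n + A\<close>, \<open>1 + \<dots> + 1 + A = n + n + R\<close> and \<open>1 + \<dots> + 1 + B + B = n + n + R\<close>
  have color sums congruent to \<open>\<chi> 1 + \<chi> A\<close>, \<open>\<chi> A + \<chi> R\<close> and \<open>\<chi> 1 + \<chi> R\<close>,
  so they cannot all be odd.
\<close>

text \<open>The common shape of the three solutions: \<open>k - 5\<close> ones with \<open>p\<close>
  and \<open>q\<close> on the left, \<open>n\<close>, \<open>n\<close>, \<open>r\<close> on the
  right. The repeated \<open>n\<close> cancels modulo 2, so \<open>\<chi> n\<close> is absent from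
  \<open>col\<close>.\<close>

lemma zero_sum_solution_exists:
  fixes k n p q r :: nat and \<chi> :: "nat \<Rightarrow> nat"
  assumes "k \<ge> 6" and "p \<in> {1..n}" and "q \<in> {1..n}" and "r \<in> {1..n}"
    and eq: "k - 5 + p + q = n + n + r"
    and col: "even ((k - 5) * \<chi> 1 + \<chi> p + \<chi> q + \<chi> r)"
  shows "\<exists>x. x ` {1..k} \<subseteq> {1..n} \<and> schur_solution 1 1 k 2 1 x \<and>
           [(\<Sum>i = 1..k. \<chi> (x i)) = 0] (mod 2)"
proof -
  obtain j where k: "k = j + 5"
    using assms(1) by (intro that[of "k - 5"]) simp
  define x where "x = (\<lambda>i. if i \<le> j then 1 else if i = j + 1 then p else if i = j + 2 then q
                            else if i = j + 5 then r else n)"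
  have front: "(\<Sum>i = 1..j. F (x i)) = j * F 1" for F :: "nat \<Rightarrow> nat"
    by (simp add: x_def)
  \<comment> \<open>\<open>F = \<chi>\<close> will give the color sum, \<open>F = id\<close> the
    equation.\<close>
  have left: "(\<Sum>i = 1..j + 2. F (x i)) = j * F 1 + F p + F q" for F :: "nat \<Rightarrow> nat"
    using front[of F] by (simp add: numeral_2_eq_2) (simp add: x_def)
  have right: "x (j + 3) = n" "x (j + 4) = n" "x (j + 5) = r"
    by (simp_all add: x_def)
  have "{1..k} = {1..j + 2} \<union> {j + 3, j + 4, j + 5}"
    using k by auto
  then have "(\<Sum>i = 1..k. \<chi> (x i)) = j * \<chi> 1 + \<chi> p + \<chi> q + 2 * \<chi> n + \<chi> r"
    using left[of \<chi>] right by (simp add: sum.union_disjoint)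
  then have "[(\<Sum>i = 1..k. \<chi> (x i)) = 0] (mod 2)"
    using col k by (auto simp: cong_0_iff)
  moreover have "schur_solution 1 1 k 2 1 x"
    using left[of id] right eq k by (subst schur_solution_1_1_2_1) (simp_all add: add.commute)
  moreover have "x ` {1..k} \<subseteq> {1..n}"
    using assms(2-4) by (auto simp: x_def)
  ultimately show ?thesis
    by blast
qed

lemma zero_sum_solvable_if:
  fixes k n :: nat
  assumes "even k" and "k \<ge> 6" and lower: "2 * k \<le> 5 * n + 7" and upper: "2 * n + 4 \<le> k"
  shows "zero_sum_solvable 2 1 1 k 2 1 n"
  unfolding zero_sum_solvable_def
proof (intro allI impI)
  fix \<chi> :: "nat \<Rightarrow> nat"
  define A where "A = k - 3 - 2 * n"
  define B where "B = (A + 1) div 2"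
  define R where "R = 2 * k - 7 - 4 * n"
  have AR: "A + 2 * n + 3 = k" "R + 4 * n + 7 = 2 * k"
    using upper by (simp_all add: A_def R_def)
  have "odd A"
    using AR(1) \<open>even k\<close> by presburger
  then have B: "2 * B = A + 1"
    by (simp add: B_def)
  \<comment> \<open>For \<open>R\<close>, being at least 1 is \<open>upper\<close> and being at most
    \<open>n\<close> is \<open>lower\<close>.\<close>
  have mem: "A \<in> {1..n}" "B \<in> {1..n}" "R \<in> {1..n}" "1 \<in> {1..n}"
    using AR B odd_pos[OF \<open>odd A\<close>] lower unfolding atLeastAtMost_iff
    by linarith+
  \<comment> \<open>Hence the block of ones counts as \<open>\<chi> 1\<close> modulo 2.\<close>
  have "odd (k - 5)"
    using \<open>even k\<close> \<open>k \<ge> 6\<close> by simp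
  then consider "even ((k - 5) * \<chi> 1 + \<chi> 1 + \<chi> 1 + \<chi> A)"
    | "even ((k - 5) * \<chi> 1 + \<chi> 1 + \<chi> A + \<chi> R)"
    | "even ((k - 5) * \<chi> 1 + \<chi> B + \<chi> B + \<chi> R)"
    by auto
  then show "\<exists>x. x ` {1..k} \<subseteq> {1..n} \<and> schur_solution 1 1 k 2 1 x \<and>
           [(\<Sum>i = 1..k. \<chi> (x i)) = 0] (mod 2)"
  proof cases
    case 1
    show ?thesis
      by (rule zero_sum_solution_exists[OF \<open>k \<ge> 6\<close> mem(4,4,1) _ 1]) (use AR B \<open>k \<ge> 6\<close> in linarith)
  next
    case 2
    show ?thesis
      by (rule zero_sum_solution_exists[OF \<open>k \<ge> 6\<close> mem(4,1,3) _ 2]) (use AR B \<open>k \<ge> 6\<close> in linarith)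
  next
    case 3
    show ?thesis
      by (rule zero_sum_solution_exists[OF \<open>k \<ge> 6\<close> mem(2,2,3) _ 3]) (use AR B \<open>k \<ge> 6\<close> in linarith)
  qed
qed

lemma not_zero_sum_solvable_if:
  fixes k n :: nat
  assumes "k \<ge> 6" and upper: "5 * n + 8 \<le> 2 * k"
  shows "\<not> zero_sum_solvable 2 1 1 k 2 1 n"
proof
  \<comment> \<open>Additive form, since \<open>3 * n + 4 - k\<close> may truncate.\<close>
  define \<chi> :: "nat \<Rightarrow> nat" where "\<chi> y = (if y + k \<le> 3 * n + 4 then 0 else 1)" for y
  assume "zero_sum_solvable 2 1 1 k 2 1 n"
  moreover have "\<chi> ` {1..n} \<subseteq> {0..<2}"
    by (auto simp: \<chi>_def)
  ultimately obtain x where x: "x ` {1..k} \<subseteq> {1..n}" and sol: "schur_solution 1 1 k 2 1 x"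
    and col: "[(\<Sum>i = 1..k. \<chi> (x i)) = 0] (mod 2)"
    unfolding zero_sum_solvable_def by blast
  have x_ge: "1 \<le> x i" and x_le: "x i \<le> n" if "i \<in> {1..k}" for i
    using subsetD[OF x imageI[OF that]] by auto
  have eq: "(\<Sum>i = 1..k - 3. x i) = x (k - 2) + x (k - 1) + x k"
    using sol \<open>k \<ge> 6\<close> by (subst (asm) schur_solution_1_1_2_1) simp_all
  have rhs_le: "x (k - 2) \<le> n" "x (k - 1) \<le> n" "x k \<le> n"
    using x_le \<open>k \<ge> 6\<close> by auto
  have left: "\<chi> (x i) = 0" if i: "i \<in> {1..k - 3}" for i
  proof -
    \<comment> \<open>The other \<open>k - 4\<close> left terms are at least 1 each; this gives the
      threshold.\<close>
    have "k - 4 = (\<Sum>j \<in> {1..k - 3} - {i}. 1)"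
      using i by simp
    also have "\<dots> \<le> (\<Sum>j \<in> {1..k - 3} - {i}. x j)"
      using x_ge by (intro sum_mono) auto
    finally have "k - 4 + x i \<le> (\<Sum>j = 1..k - 3. x j)"
      using sum.remove[OF finite_atLeastAtMost i, of x] by linarith
    then have "x i + k \<le> 3 * n + 4"
      using eq rhs_le by linarith
    then show ?thesis
      by (simp add: \<chi>_def)
  qed
  have "(\<Sum>i = 1..k - 3. 1) \<le> (\<Sum>i = 1..k - 3. x i)"
    using x_ge by (intro sum_mono) auto
  then have "k - 3 \<le> x (k - 2) + x (k - 1) + x k"
    using eq by simp
  \<comment> \<open>Two right terms are at most \<open>n\<close> each, so the third is at least
    \<open>k - 3 - 2 * n\<close>, which \<open>upper\<close> puts above the threshold.\<close>
  then have right: "\<chi> (x (k - 2)) = 1" "\<chi> (x (k - 1)) = 1" "\<chi> (x k) = 1"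
    using rhs_le upper by (auto simp: \<chi>_def)
  have "{1..k} = {1..k - 3} \<union> {k - 2, k - 1, k}"
    using \<open>k \<ge> 6\<close> by auto
  then have "(\<Sum>i = 1..k. \<chi> (x i)) = (\<Sum>i \<in> {1..k - 3} \<union> {k - 2, k - 1, k}. \<chi> (x i))"
    by simp
  also have "\<dots> = (\<Sum>i = 1..k - 3. \<chi> (x i)) + (\<Sum>i \<in> {k - 2, k - 1, k}. \<chi> (x i))"
    using \<open>k \<ge> 6\<close> by (intro sum.union_disjoint) auto
  also have "\<dots> = 3"
  proof -
    have "k - 2 \<noteq> k - 1" "k - 2 \<noteq> k" "k - 1 \<noteq> k"
      using \<open>k \<ge> 6\<close> by auto
    then show ?thesis
      using left right by simp
  qed
  finally show False
    using col by (simp add: cong_0_iff)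
qed

theorem theorem8:
  fixes k t s :: nat and u :: int
  assumes "even k" and "k \<ge> 6"
    and "k = 10 * t + s" and "s \<in> {0, 2, 4, 6, 8}"
    and "u = (if s \<in> {6, 8} then int t else int t - 1)"
  shows "(\<exists>n > 0. zero_sum_solvable 2 1 1 k 2 1 n) \<and>
    int (zero_sum_schur_number 2 1 1 k 2 1) = int k div 2 - u - 2"
proof -
  obtain h where h: "k = 2 * h"
    using \<open>even k\<close> by blast
  then have half: "int k div 2 = int h"
    by simp
  have s_u: "s = 0 \<and> u = int t - 1 \<or> s = 2 \<and> u = int t - 1 \<or> s = 4 \<and> u = int t - 1 \<or>
      s = 6 \<and> u = int t \<or> s = 8 \<and> u = int t"
    using assms(4,5) by force
  define N where "N = nat (int h - u - 2)"
  have "0 < int h - u - 2"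
    using s_u h assms(2,3) by linarith
  then have N: "int N = int h - u - 2" "0 < N"
    by (simp_all add: N_def)
  have "t > 0 \<or> s = 6 \<or> s = 8"
    using s_u assms(2,3) by auto
  then have "u \<ge> 0"
    using s_u by auto
  \<comment> \<open>The first two make \<open>N\<close> the ceiling of
    \<open>(2 * k - 7) / 5\<close>; the third amounts to \<open>u \<ge> 0\<close>, as
    \<open>2 * N + 4 = k - 2 * u\<close>.\<close>
  then have bounds: "2 * k \<le> 5 * N + 7" "5 * N \<le> 2 * k - 3" "2 * N + 4 \<le> k"
    using s_u h assms(2,3) N(1) by linarith+
  have solvable: "zero_sum_solvable 2 1 1 k 2 1 N"
    using \<open>even k\<close> \<open>k \<ge> 6\<close> bounds(1,3) by (rule zero_sum_solvable_if)
  moreover have "zero_sum_schur_number 2 1 1 k 2 1 = N"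
    unfolding zero_sum_schur_number_def
  proof (rule Least_equality)
    show "0 < N \<and> zero_sum_solvable 2 1 1 k 2 1 N"
      using N(2) solvable by simp
  next
    fix n
    assume n: "0 < n \<and> zero_sum_solvable 2 1 1 k 2 1 n"
    then have "\<not> 5 * n + 8 \<le> 2 * k"
      using not_zero_sum_solvable_if \<open>k \<ge> 6\<close> by blast
    then show "N \<le> n"
      using bounds(2) by linarith
  qed
  ultimately show ?thesis
    using N half by auto
qed

end
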